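(* For every real Banach space $X$ with $\dim X\ge 2$, $$\mathrm{DR}_B(X)\le \mathrm{DR}(X).$$ Consequently, if $X$ is uniformly non-square, then $\mathrm{DR}_B(X)<2$.
   Context: Birkhoff orthogonality: $x\perp_B y$ iff $\|x+\lambda y\|\ge\|x\|$ for all $\lambda\in\mathbb R$. For nonzero $x,y\in X$ put $\alpha[x,y]=\left\|\frac{x}{\|x\|}-\frac{y}{\|y\|}\right\|$ and $\beta[x,y]=\left\|\frac{x}{\|y\|}-\frac{y}{\|x\|}\right\|$. Define $$\mathrm{DR}(X)=\sup\left\{\frac{\alpha[x,y]}{\beta[x,y]}: x,y\ne 0,\ \beta[x,y]\ne 0\right\},$$ $$\mathrm{DR}_B(X)=\sup\left\{\frac{\alpha[x,y]}{\beta[x,y]}: x,y\in X\setminus\{0\},\ x\perp_B y,\ \beta[x,y]\ne 0\right\}.$$ $X$ is uniformly non-square iff $\varepsilon_0(X)<2$, where $\varepsilon_0(X)=\sup\{\varepsilon\in[0,2]:\delta_X(\varepsilon)=0\}$ and $\delta_X(\varepsilon)=\inf\{1-\|\frac{x+y}{2}\|: \|x\|=\|y\|=1,\ \|x-y\|\ge\varepsilon\}$. *)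

theory Defs
  imports "HOL-Analysis.Analysis"
begin

text \<open>A normed space is represented by a type, passed to the space-level constants as a
  \<open>TYPE('a)\<close> token.\<close>

definition birkhoff_orth :: "'a::real_normed_vector \<Rightarrow> 'a \<Rightarrow> bool"  (infix "\<bottom>\<^sub>B" 50)
  where "x \<bottom>\<^sub>B y \<longleftrightarrow> (\<forall>l::real. norm (x + l *\<^sub>R y) \<ge> norm x)"

definition ang_alpha :: "'a::real_normed_vector \<Rightarrow> 'a \<Rightarrow> real"
  where "ang_alpha x y = norm (x /\<^sub>R norm x - y /\<^sub>R norm y)"

definition ang_beta :: "'a::real_normed_vector \<Rightarrow> 'a \<Rightarrow> real"
  where "ang_beta x y = norm (x /\<^sub>R norm y - y /\<^sub>R norm x)"

definition DR :: "'a::real_normed_vector itself \<Rightarrow> real"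
  where "DR _ = Sup {ang_alpha x y / ang_beta x y | x y :: 'a.
                       x \<noteq> 0 \<and> y \<noteq> 0 \<and> ang_beta x y \<noteq> 0}"

definition DR_B :: "'a::real_normed_vector itself \<Rightarrow> real"
  where "DR_B _ = Sup {ang_alpha x y / ang_beta x y | x y :: 'a.
                         x \<noteq> 0 \<and> y \<noteq> 0 \<and> x \<bottom>\<^sub>B y \<and> ang_beta x y \<noteq> 0}"

definition modulus_of_convexity :: "'a::real_normed_vector itself \<Rightarrow> real \<Rightarrow> real"
  where "modulus_of_convexity _ e =
           Inf {1 - norm ((x + y) /\<^sub>R 2) | x y :: 'a. norm x = 1 \<and> norm y = 1 \<and> norm (x - y) \<ge> e}"

definition convexity_characteristic :: "'a::real_normed_vector itself \<Rightarrow> real"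
  where "convexity_characteristic X = Sup {e \<in> {0..2}. modulus_of_convexity X e = 0}"

definition uniformly_nonsquare :: "'a::real_normed_vector itself \<Rightarrow> bool"
  where "uniformly_nonsquare X \<longleftrightarrow> convexity_characteristic X < 2"

text \<open>The library's \<^const>\<open>dim\<close> is 0 on infinite-dimensional spaces, so \<open>dim UNIV \<ge> 2\<close> would
  exclude them.\<close>

definition dim_ge_2 :: "'a::real_normed_vector itself \<Rightarrow> bool"
  where "dim_ge_2 _ \<longleftrightarrow> (\<exists>S::'a set. independent S \<and> card S = 2)"

text \<open>The real \<^const>\<open>Sup\<close> and \<^const>\<open>Inf\<close> are unspecified for empty or unbounded sets. In
  dimension at least 2 this does not arise: the facts below show that every set used above is
  nonempty and bounded on the relevant side.\<close>

lemma ang_alpha_le: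
  fixes x y :: "'a::real_normed_vector"
  assumes "x \<noteq> 0" "y \<noteq> 0"
  shows "ang_alpha x y \<le> 2 * ang_beta x y"
proof -
  have main: "ang_alpha x y \<le> 2 * ang_beta x y"
    if nz: "x \<noteq> 0" "y \<noteq> 0" and le: "norm y \<le> norm x" for x y :: 'a
  proof -
    define a b where "a = norm x" and "b = norm y"
    have ab: "0 < b" "b \<le> a" using nz le by (auto simp: a_def b_def)
    have eq: "x /\<^sub>R a - y /\<^sub>R b = (b / a) *\<^sub>R (x /\<^sub>R b - y /\<^sub>R a) - (1 / b - b / a\<^sup>2) *\<^sub>R y"
    proof -
      have "(b / a) *\<^sub>R (x /\<^sub>R b - y /\<^sub>R a) - (1 / b - b / a\<^sup>2) *\<^sub>R y =
            ((b / a) / b) *\<^sub>R x - ((b / a) / a + (1 / b - b / a\<^sup>2)) *\<^sub>R y"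
        by (simp add: scaleR_add_left scaleR_diff_right divide_inverse)
      moreover have "(b / a) / b = inverse a" "(b / a) / a + (1 / b - b / a\<^sup>2) = inverse b"
        using ab by (simp_all add: field_simps power2_eq_square)
      ultimately show ?thesis by simp
    qed
    have B: "a / b - b / a \<le> ang_beta x y"
      using norm_triangle_ineq2[of "x /\<^sub>R b" "y /\<^sub>R a"] ab
      unfolding ang_beta_def a_def[symmetric] b_def[symmetric]
      by (simp add: a_def[symmetric] b_def[symmetric] field_simps)
    have ba: "b / a \<ge> 0" using ab by simp
    have nn: "1 / b - b / a\<^sup>2 \<ge> 0"
      using ab power_mono[of b a 2] by (simp add: field_simps power2_eq_square)
    have "ang_alpha x y \<le> (b / a) * ang_beta x y + (1 / b - b / a\<^sup>2) * b"
      unfolding ang_alpha_def ang_beta_def a_def[symmetric] b_def[symmetric] eq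
      by (rule order_trans[OF norm_triangle_ineq4]) (use ab nn in \<open>simp add: b_def[symmetric] abs_of_nonneg\<close>)
    also have "(1 / b - b / a\<^sup>2) * b = (b / a) * (a / b - b / a)"
      using ab by (simp add: field_simps power2_eq_square)
    also have "(b / a) * ang_beta x y + \<dots> \<le> (b / a) * (2 * ang_beta x y)"
      using mult_left_mono[OF B ba] by (simp only: mult_2 distrib_left add_left_mono)
    also have "\<dots> \<le> 1 * (2 * ang_beta x y)"
      by (rule mult_right_mono) (use ab in \<open>auto simp: ang_beta_def\<close>)
    finally show ?thesis by simp
  qed
  have sym: "ang_alpha x y = ang_alpha y x" "ang_beta x y = ang_beta y x"
    by (simp_all add: ang_alpha_def ang_beta_def norm_minus_commute)
  show ?thesis
    using main[of x y] main[of y x] assms sym by (cases "norm y \<le> norm x") auto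
qed

lemma bdd_above_DR:
  "bdd_above {ang_alpha x y / ang_beta x y | x y :: 'a::real_normed_vector.
      x \<noteq> 0 \<and> y \<noteq> 0 \<and> ang_beta x y \<noteq> 0}"
proof (rule bdd_aboveI[of _ 2], clarify)
  fix x y :: 'a
  assume "x \<noteq> 0" "y \<noteq> 0" "ang_beta x y \<noteq> 0"
  then show "ang_alpha x y / ang_beta x y \<le> 2"
    using ang_alpha_le[of x y] by (simp add: divide_le_eq ang_beta_def)
qed

lemma nonempty_DR_B:
  assumes "dim_ge_2 TYPE('a::real_normed_vector)"
  shows "\<exists>x y :: 'a. x \<noteq> 0 \<and> y \<noteq> 0 \<and> x \<bottom>\<^sub>B y \<and> ang_beta x y \<noteq> 0"
proof -
  obtain S :: "'a set" where S: "independent S" "card S = 2"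
    using assms by (auto simp: dim_ge_2_def)
  then obtain u v where uv: "S = {u, v}" "u \<noteq> v" by (auto simp: card_2_iff)
  have v0: "v \<noteq> 0" using S uv dependent_zero by blast
  have "u \<notin> span {v}" using S uv by (simp add: independent_insert)
  then have ns: "u \<noteq> k *\<^sub>R v" for k by (metis span_breakdown_eq diff_self span_zero)
  define f where "f l = norm (u + l *\<^sub>R v)" for l :: real
  define R where "R = 2 * norm u / norm v"
  have R0: "R \<ge> 0" by (simp add: R_def)
  have "\<exists>l0\<in>{-R..R}. \<forall>l\<in>{-R..R}. f l0 \<le> f l"
    by (rule continuous_attains_inf) (use R0 in \<open>auto simp: f_def intro!: continuous_intros\<close>)
  then obtain l0 where "\<forall>l\<in>{-R..R}. f l0 \<le> f l" by blast
  then have l0: "f l0 \<le> f l" if "\<bar>l\<bar> \<le> R" for l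
    using that by (simp add: abs_le_iff minus_le_iff)
  have min: "f l0 \<le> f l" for l
  proof (cases "\<bar>l\<bar> \<le> R")
    case False
    then have "2 * norm u < \<bar>l\<bar> * norm v" using v0 by (simp add: R_def field_simps)
    moreover have "norm (l *\<^sub>R v) - norm u \<le> f l"
      using norm_triangle_ineq2[of "l *\<^sub>R v" "- u"] by (simp add: f_def add.commute)
    moreover have "f l0 \<le> f 0" using l0[of 0] R0 by simp
    ultimately show ?thesis by (simp add: f_def)
  qed (rule l0)
  define x where "x = u + l0 *\<^sub>R v"
  have x0: "x \<noteq> 0" using ns[of "- l0"] by (auto simp: x_def eq_neg_iff_add_eq_0)
  have "x \<bottom>\<^sub>B v"
    unfolding birkhoff_orth_def
    using min[of "l0 + _"] by (simp add: f_def x_def scaleR_add_left add.assoc)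
  moreover have "ang_beta x v \<noteq> 0"
  proof
    assume "ang_beta x v = 0"
    then have "x /\<^sub>R norm v = v /\<^sub>R norm x" by (simp add: ang_beta_def)
    then have "norm v *\<^sub>R (x /\<^sub>R norm v) = norm v *\<^sub>R (v /\<^sub>R norm x)" by simp
    then have "x = (norm v / norm x) *\<^sub>R v" using v0 by (simp add: divide_inverse)
    then have "u = (norm v / norm x - l0) *\<^sub>R v"
      by (simp add: x_def scaleR_left_diff_distrib eq_diff_eq)
    then show False using ns by blast
  qed
  ultimately show ?thesis using x0 v0 by blast
qed

lemma bdd_below_modulus:
  "bdd_below {1 - norm ((x + y) /\<^sub>R 2) | x y :: 'a::real_normed_vector.
      norm x = 1 \<and> norm y = 1 \<and> norm (x - y) \<ge> e}"
proof (rule bdd_belowI[of _ 0], clarify)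
  fix x y :: 'a
  assume "norm x = 1" "norm y = 1"
  then show "0 \<le> 1 - norm ((x + y) /\<^sub>R 2)"
    using norm_triangle_ineq[of x y] by simp
qed

lemma nonempty_modulus:
  assumes "dim_ge_2 TYPE('a::real_normed_vector)" "e \<le> 2"
  shows "\<exists>x y :: 'a. norm x = 1 \<and> norm y = 1 \<and> norm (x - y) \<ge> e"
proof -
  obtain x :: 'a where "x \<noteq> 0" using nonempty_DR_B[OF assms(1)] by blast
  define u where "u = x /\<^sub>R norm x"
  have u: "norm u = 1" using \<open>x \<noteq> 0\<close> by (simp add: u_def)
  have "u - - u = 2 *\<^sub>R u" by (simp add: scaleR_2)
  then have "norm (u - - u) = 2" by (simp only: norm_scaleR u)
  then have "norm u = 1 \<and> norm (- u) = 1 \<and> norm (u - - u) \<ge> e"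
    using u assms(2) by (simp only: norm_minus_cancel)
  then show ?thesis by blast
qed

lemma modulus_0:
  assumes "dim_ge_2 TYPE('a::real_normed_vector)"
  shows "modulus_of_convexity TYPE('a) 0 = 0"
proof -
  obtain u :: 'a where u: "norm u = 1" using nonempty_modulus[OF assms, of 0] by auto
  have half: "(u + u) /\<^sub>R 2 = u" by (simp add: scaleR_2[symmetric])
  have "0 = 1 - norm ((u + u) /\<^sub>R 2) \<and> norm u = 1 \<and> norm u = 1 \<and> norm (u - u) \<ge> 0"
    unfolding half using u by simp
  then have "0 \<in> {1 - norm ((x + y) /\<^sub>R 2) | x y :: 'a. norm x = 1 \<and> norm y = 1 \<and> norm (x - y) \<ge> 0}"
    by blast
  then show ?thesis
    unfolding modulus_of_convexity_def
  proof (rule cInf_eq_minimum)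
    fix r assume "r \<in> {1 - norm ((x + y) /\<^sub>R 2) | x y :: 'a.
                         norm x = 1 \<and> norm y = 1 \<and> norm (x - y) \<ge> 0}"
    then obtain x y :: 'a where "r = 1 - norm ((x + y) /\<^sub>R 2)" "norm x = 1" "norm y = 1" by blast
    then show "0 \<le> r" using norm_triangle_ineq[of x y] by simp
  qed
qed

end

theory Submission
  imports Defs
begin

text \<open>The inequality holds because the supremum defining \<open>DR_B\<close> runs over fewer pairs. For the
  strict bound, suppose that the ratio of some pair \<open>x\<close>, \<open>y\<close> with \<open>norm y \<le> norm x\<close> is close to 2.
  Put \<open>u = x / norm x\<close>, \<open>v = y / norm y\<close>, \<open>t = norm y / norm x\<close>, \<open>s = t\<^sup>2\<close> and
  \<open>w = (u - s v) / (1 - s)\<close>, so that \<open>u = s v + (1 - s) w\<close> and the ratio is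
  \<open>t \<cdot> norm (w - v) / norm w\<close>. Then \<open>norm w \<ge> 1\<close>, and the ratio being close to 2 forces
  \<open>norm w\<close> and \<open>t\<close> close to 1 and \<open>norm (w - v)\<close> close to 2. The norm is convex along the line
  through \<open>v\<close> and \<open>w\<close> and equals 1 at both \<open>v\<close> and \<open>u\<close>, so it is at least 1 at \<open>(v + w) / 2\<close>.
  Hence \<open>v\<close> and \<open>w / norm w\<close> almost span a square, which uniform non-squareness excludes.\<close>

lemma unit_almost_square:
  fixes u v :: "'a::real_normed_vector"
  assumes u: "norm u = 1" and v: "norm v = 1" and t: "0 < t" "t \<le> 1"
    and h: "0 < h" "h \<le> 1/2"
    and ratio: "(2 - h) * norm (u /\<^sub>R t - t *\<^sub>R v) < norm (u - v)"
  obtains w where "norm w = 1" "norm (v - w) \<ge> 2 - h" "norm (v + w) \<ge> 2 - 2 * h"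
proof -
  define s where "s = t\<^sup>2"
  \<comment> \<open>At \<open>t = 1\<close> the two norms in \<open>ratio\<close> coincide, and
    \<open>2 - h > 1\<close> rules that out. Hence \<open>s < 1\<close> and \<open>w\<close> is well
    defined.\<close>
  have "t \<noteq> 1"
  proof
    assume "t = 1"
    then have "(1 - h) * norm (u - v) < 0" using ratio by (simp add: algebra_simps)
    then show False using h by (simp add: mult_less_0_iff)
  qed
  then have t1: "t < 1" using t by simp
  then have s: "0 < s" "s < 1" using t by (auto simp: s_def power_less_one_iff)
  define w where "w = (u - s *\<^sub>R v) /\<^sub>R (1 - s)"
  define r where "r = norm w"
  have u_sv: "u - s *\<^sub>R v = (1 - s) *\<^sub>R w" using s by (simp add: w_def)
  have "u - v = (u - s *\<^sub>R v) - (1 - s) *\<^sub>R v" by (simp add: algebra_simps)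
  then have u_v: "u - v = (1 - s) *\<^sub>R (w - v)" by (simp add: u_sv scaleR_diff_right)
  have "u /\<^sub>R t - t *\<^sub>R v = (u - s *\<^sub>R v) /\<^sub>R t"
    using t by (simp add: s_def scaleR_diff_right power2_eq_square)
  then have "norm (u /\<^sub>R t - t *\<^sub>R v) = (1 - s) * (r / t)"
    using t s by (simp add: u_sv r_def divide_inverse)
  then have "(1 - s) * ((2 - h) * (r / t)) < (1 - s) * norm (w - v)"
    using ratio s by (simp add: u_v mult.left_commute)
  then have "(2 - h) * (r / t) < norm (w - v)" using s by (simp only: mult_less_cancel_left_pos diff_gt_0_iff_gt)
  then have big: "(2 - h) * r < t * norm (w - v)"
    using t by (simp add: field_simps)
  have "1 - s \<le> norm (u - s *\<^sub>R v)"
    using norm_triangle_ineq2[of u "s *\<^sub>R v"] u v s by simp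
  then have r1: "r \<ge> 1" using s by (simp add: u_sv r_def)
  have wv: "norm (w - v) \<le> r + 1" using norm_triangle_ineq4[of w v] v by (simp add: r_def)
  have "t * norm (w - v) \<le> norm (w - v)" using t by (simp add: mult_left_le_one_le)
  then have far: "(2 - h) * r < norm (w - v)" using big by linarith
  have rh: "(1 - h) * r < 1" using far wv by (simp add: algebra_simps)
  \<comment> \<open>The crude bound \<open>r <= 2\<close> is fed back into \<open>rh\<close>:
    \<open>r < 1 + h * r <= 1 + 2 * h\<close>.\<close>
  have "(1/2) * r \<le> (1 - h) * r" by (rule mult_right_mono) (use h r1 in auto)
  then have "r \<le> 2" using rh by simp
  then have "h * r \<le> h * 2" using h by simp
  then have r_le: "r - 1 \<le> 2 * h" using rh by (simp add: algebra_simps)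
  have "t * norm (w - v) \<le> t * (2 * r)" by (rule mult_left_mono) (use wv r1 t in auto)
  then have "(2 - h) * r < t * (2 * r)" using big by linarith
  then have "(2 - h) * r < (2 * t) * r" by (simp add: mult.commute mult.left_commute)
  then have "2 - h < 2 * t" using r1 by (simp add: mult_less_cancel_right)
  then have "3/4 \<le> t" using h by simp
  then have "(3/4)\<^sup>2 \<le> s" unfolding s_def by (rule power_mono) simp
  then have s_half: "1/2 \<le> s" by (simp add: power2_eq_square)
  \<comment> \<open>Since \<open>s >= 1/2\<close>, this writes \<open>u\<close> as a convex
    combination of \<open>v\<close> and the midpoint of \<open>v\<close> and \<open>w\<close>, with
    weights \<open>2 * s - 1\<close> and \<open>2 * (1 - s)\<close>. As \<open>u\<close> and
    \<open>v\<close> have norm 1, the midpoint has norm at least 1.\<close>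
  have "u = s *\<^sub>R v + (1 - s) *\<^sub>R w" using u_sv by (simp add: algebra_simps)
  also have "\<dots> = (2 * s - 1) *\<^sub>R v + (1 - s) *\<^sub>R (v + w)"
    by (simp add: scaleR_right_distrib flip: scaleR_left_distrib)
  finally have "1 \<le> norm ((2 * s - 1) *\<^sub>R v) + norm ((1 - s) *\<^sub>R (v + w))"
    using norm_triangle_ineq u by metis
  then have "(1 - s) * 2 \<le> (1 - s) * norm (v + w)" using s s_half v by simp
  then have sum: "2 \<le> norm (v + w)"
    using s by (simp only: mult_le_cancel_left_pos diff_gt_0_iff_gt)
  define w' where "w' = w /\<^sub>R r"
  have w': "norm w' = 1" using r1 by (simp add: w'_def flip: r_def)
  have "w = r *\<^sub>R w'" using r1 by (simp add: w'_def)
  then have "w - w' = (r - 1) *\<^sub>R w'" by (simp add: scaleR_diff_left)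
  then have ww': "norm (w - w') = r - 1" using w' r1 by simp
  have "norm (w - v) \<le> norm (v - w') + (r - 1)"
    using norm_triangle_ineq4[of "w - w'" "v - w'"] ww' by simp
  \<comment> \<open>Normalising \<open>w\<close> costs \<open>r - 1\<close>, but \<open>far\<close>
    grows with \<open>r\<close>: what remains exceeds
    \<open>(1 - h) * r + 1 >= 2 - h\<close>.\<close>
  moreover have "(1 - h) * 1 \<le> (1 - h) * r" by (rule mult_left_mono) (use h r1 in auto)
  ultimately have 1: "norm (v - w') \<ge> 2 - h" using far by (simp add: algebra_simps)
  have "norm (v + w) \<le> norm (v + w') + (r - 1)"
    using norm_triangle_ineq[of "v + w'" "w - w'"] ww' by (simp add: algebra_simps)
  then have 2: "norm (v + w') \<ge> 2 - 2 * h" using sum r_le by linarith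
  show ?thesis by (rule that[OF w' 1 2])
qed

text \<open>Both angular quantities are symmetric, so \<open>norm y <= norm x\<close> may be
  assumed; rescaling to unit vectors then leaves only the quotient \<open>t\<close> of the
  norms.\<close>

lemma almost_square:
  fixes x y :: "'a::real_normed_vector"
  assumes nz: "x \<noteq> 0" "y \<noteq> 0" and h: "0 < h" "h \<le> 1/2"
    and ratio: "(2 - h) * ang_beta x y < ang_alpha x y"
  obtains v w :: 'a
  where "norm v = 1" "norm w = 1" "norm (v - w) \<ge> 2 - h" "norm (v + w) \<ge> 2 - 2 * h"
proof -
  note square = that
  have wlog: thesis
    if nz: "x \<noteq> 0" "y \<noteq> 0" and le: "norm y \<le> norm x"
      and ratio: "(2 - h) * ang_beta x y < ang_alpha x y" for x y :: 'a
  proof -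
    define u v t where "u = x /\<^sub>R norm x" and "v = y /\<^sub>R norm y" and "t = norm y / norm x"
    have *: "norm u = 1" "norm v = 1" "0 < t" "t \<le> 1"
      using nz le by (auto simp: u_def v_def t_def)
    have "u /\<^sub>R t = x /\<^sub>R norm y" "t *\<^sub>R v = y /\<^sub>R norm x"
      using nz by (simp_all add: u_def v_def t_def field_simps)
    then have "ang_beta x y = norm (u /\<^sub>R t - t *\<^sub>R v)" "ang_alpha x y = norm (u - v)"
      by (simp_all only: ang_beta_def ang_alpha_def u_def v_def)
    then show thesis
      using unit_almost_square[OF * h] ratio * square by metis
  qed
  have sym: "ang_alpha x y = ang_alpha y x" "ang_beta x y = ang_beta y x"
    by (simp_all add: ang_alpha_def ang_beta_def norm_minus_commute)
  show thesis
    using wlog[of x y] wlog[of y x] nz ratio sym by (cases "norm y \<le> norm x") auto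
qed

lemma uniformly_nonsquareE:
  assumes dim: "dim_ge_2 TYPE('a::real_normed_vector)"
    and nonsquare: "uniformly_nonsquare TYPE('a)"
  obtains e d where "e < 2" "0 < d"
    "\<And>v w :: 'a. norm v = 1 \<Longrightarrow> norm w = 1 \<Longrightarrow> norm (v - w) \<ge> e \<Longrightarrow> norm (v + w) \<le> 2 - 2 * d"
proof -
  let ?M = "modulus_of_convexity TYPE('a)"
  define c where "c = convexity_characteristic TYPE('a)"
  \<comment> \<open>The midpoint of \<open>max 0 c\<close> and 2 lies strictly above
    \<open>c\<close> and inside \<open>{0..2}\<close>, so a zero modulus at \<open>e\<close> would
    contradict \<open>c\<close> being the supremum. The modulus at \<open>e\<close> serves as
    \<open>d\<close>.\<close>
  define e where "e = (max 0 c + 2) / 2"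
  have "c < 2" using nonsquare by (simp add: uniformly_nonsquare_def c_def)
  then have e: "0 \<le> e" "e < 2" "c < e" by (auto simp: e_def max_def)
  have "?M e \<noteq> 0"
  proof
    assume "?M e = 0"
    then have "e \<in> {e \<in> {0..2}. ?M e = 0}" using e by simp
    moreover have "bdd_above {e \<in> {0..2}. ?M e = 0}" by (rule bdd_aboveI[of _ 2]) simp
    ultimately have "e \<le> c"
      unfolding c_def convexity_characteristic_def by (rule cSup_upper)
    then show False using e by simp
  qed
  moreover have "0 \<le> ?M e"
    unfolding modulus_of_convexity_def
  proof (rule cInf_greatest)
    show "{1 - norm ((x + y) /\<^sub>R 2) | x y :: 'a.
            norm x = 1 \<and> norm y = 1 \<and> norm (x - y) \<ge> e} \<noteq> {}"
      using nonempty_modulus[OF dim, of e] e by auto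
  next
    fix r assume "r \<in> {1 - norm ((x + y) /\<^sub>R 2) | x y :: 'a.
                         norm x = 1 \<and> norm y = 1 \<and> norm (x - y) \<ge> e}"
    then obtain x y :: 'a where "r = 1 - norm ((x + y) /\<^sub>R 2)" "norm x = 1" "norm y = 1" by blast
    then show "0 \<le> r" using norm_triangle_ineq[of x y] by simp
  qed
  ultimately have pos: "0 < ?M e" by simp
  have "norm (v + w) \<le> 2 - 2 * ?M e"
    if vw: "norm v = 1" "norm w = 1" "norm (v - w) \<ge> e" for v w :: 'a
  proof -
    have "?M e \<le> 1 - norm ((v + w) /\<^sub>R 2)"
      unfolding modulus_of_convexity_def
      by (rule cInf_lower[OF _ bdd_below_modulus]) (use vw in blast)
    then show ?thesis by simp
  qed
  with e pos that show thesis by blast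
qed

lemma DR_B_le_DR:
  assumes "dim_ge_2 TYPE('a::real_normed_vector)"
  shows "DR_B TYPE('a) \<le> DR TYPE('a)"
  unfolding DR_B_def DR_def
  by (rule cSup_subset_mono[OF _ bdd_above_DR]) (use nonempty_DR_B[OF assms] in blast)+

text \<open>A single \<open>h\<close> bounds all ratios by \<open>2 - h\<close>, so the supremum
  itself stays below 2.\<close>

lemma DR_less_2:
  assumes dim: "dim_ge_2 TYPE('a::real_normed_vector)"
    and nonsquare: "uniformly_nonsquare TYPE('a)"
  shows "DR TYPE('a) < 2"
proof -
  obtain e d where e: "e < 2" and d: "0 < d"
    and sq: "\<And>v w :: 'a. norm v = 1 \<Longrightarrow> norm w = 1 \<Longrightarrow> norm (v - w) \<ge> e
                \<Longrightarrow> norm (v + w) \<le> 2 - 2 * d"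
    using uniformly_nonsquareE[OF dim nonsquare] by metis
  \<comment> \<open>The bound \<open>2 - e\<close> puts the almost-square pair within reach of
    \<open>sq\<close>, and \<open>d / 2\<close> makes \<open>2 - 2 * h\<close> exceed
    \<open>2 - 2 * d\<close>, the contradiction sought.\<close>
  define h where "h = min (1/2) (min (2 - e) (d / 2))"
  have h: "0 < h" "h \<le> 1/2" "h \<le> 2 - e" "h < d"
    using e d unfolding h_def by linarith+
  have "DR TYPE('a) \<le> 2 - h"
    unfolding DR_def
  proof (rule cSup_least)
    show "{ang_alpha x y / ang_beta x y | x y :: 'a.
            x \<noteq> 0 \<and> y \<noteq> 0 \<and> ang_beta x y \<noteq> 0} \<noteq> {}"
      using nonempty_DR_B[OF dim] by blast
  next
    fix q assume "q \<in> {ang_alpha x y / ang_beta x y | x y :: 'a.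
                         x \<noteq> 0 \<and> y \<noteq> 0 \<and> ang_beta x y \<noteq> 0}"
    then obtain x y :: 'a where q: "q = ang_alpha x y / ang_beta x y"
      and nz: "x \<noteq> 0" "y \<noteq> 0" "ang_beta x y \<noteq> 0" by blast
    have "\<not> (2 - h) * ang_beta x y < ang_alpha x y"
    proof
      assume "(2 - h) * ang_beta x y < ang_alpha x y"
      then obtain v w :: 'a where vw: "norm v = 1" "norm w = 1" "norm (v - w) \<ge> 2 - h"
        "norm (v + w) \<ge> 2 - 2 * h"
        using almost_square[OF nz(1,2) h(1,2)] by blast
      then show False using sq[of v w] h by simp
    qed
    moreover have "ang_beta x y > 0" using nz by (simp add: ang_beta_def)
    ultimately show "q \<le> 2 - h" by (simp add: q divide_le_eq)
  qed
  then show ?thesis using h by simp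
qed

theorem proposition2p6:
  assumes "dim_ge_2 TYPE('a::banach)"
  shows "DR_B TYPE('a) \<le> DR TYPE('a) \<and>
         (uniformly_nonsquare TYPE('a) \<longrightarrow> DR_B TYPE('a) < 2)"
  using DR_B_le_DR[OF assms] DR_less_2[OF assms] by auto

end
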